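(* Let $\mathbf{s}$ be a Sturmian word of slope $\alpha$ (and arbitrary intercept $\rho$) and let $\ell\ge 1$. Then the shifted $\ell$-boundary sequence $T\partial_{\mathbf{s},\ell}$ is obtained by applying a sliding block code of length $2\ell$ to the characteristic Sturmian word $\mathbf{s}_{\alpha,\alpha}$ of slope $\alpha$. That is, there is a map $\mathcal{B}\colon\{0,1\}^{2\ell}\to 2^{\{0,1\}^\ell\times\{0,1\}^\ell}$ such that for all $n\ge 0$, $\partial_{\mathbf{s},\ell}[\ell+1+n]=\mathcal{B}(\mathbf{s}_{\alpha,\alpha}[n]\cdots\mathbf{s}_{\alpha,\alpha}[n+2\ell-1])$.
   Context: Let $\mathbb{T}=[0,1)$ and $\alpha,\rho\in\mathbb{T}$ with $\alpha$ irrational. Let $R_\alpha(x)=\{x+\alpha\}$ (fractional part). Let $I_0=[0,1-\alpha)$ (or, in the other convention, $I_0=(0,1-\alpha]$) and $I_1=\mathbb{T}\setminus I_0$. Put $\nu(x)=0$ if $x\in I_0$ and $\nu(x)=1$ otherwise. The Sturmian word $\mathbf{s}_{\alpha,\rho}$ of slope $\alpha$ and intercept $\rho$ is defined by $\mathbf{s}_{\alpha,\rho}[n]=\nu(R_\alpha^n(\rho))$, $n\ge 0$. The characteristic Sturmian word of slope $\alpha$ is $\mathbf{s}_{\alpha,\alpha}$. For an infinite word $\mathbf{x}$ over a finite alphabet $A$ and $\ell\ge 1$, the $\ell$-boundary sequence is $\partial_{\mathbf{x},\ell}=(\partial_{\mathbf{x},\ell}[n])_{n\ge\ell}$ where $\partial_{\mathbf{x},\ell}[n]=\{(u,v)\in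 A^\ell\times A^\ell\mid uyv\text{ is a factor of }\mathbf{x}\text{ for some }y\in A^{n-\ell}\}$. The shift $T$ removes the first term of a sequence, so $T\partial_{\mathbf{x},\ell}=\partial_{\mathbf{x},\ell}[\ell+1]\,\partial_{\mathbf{x},\ell}[\ell+2]\cdots$. *)

theory Defs
  imports Complex_Main "HOL-Library.FuncSet"
begin

definition unit_circle :: "real set" where
  "unit_circle = {0..<1}"

definition rotation :: "real \<Rightarrow> real \<Rightarrow> real" where
  "rotation \<alpha> x = frac (x + \<alpha>)"

text \<open>The two conventions for the half-open coding interval \<open>I\<^sub>0\<close>.\<close>

datatype coding = Left_closed | Right_closed

fun coding_interval :: "coding \<Rightarrow> real \<Rightarrow> real set" where
  "coding_interval Left_closed \<alpha> = {0..<1 - \<alpha>}"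
| "coding_interval Right_closed \<alpha> = {0<..1 - \<alpha>}"

definition coding_letter :: "coding \<Rightarrow> real \<Rightarrow> real \<Rightarrow> nat" where
  "coding_letter c \<alpha> x = (if x \<in> coding_interval c \<alpha> then 0 else 1)"

text \<open>Infinite words are functions on \<open>nat\<close>; finite words are lists.\<close>

definition sturmian_word :: "coding \<Rightarrow> real \<Rightarrow> real \<Rightarrow> nat \<Rightarrow> nat" where
  "sturmian_word c \<alpha> \<rho> n = coding_letter c \<alpha> ((rotation \<alpha> ^^ n) \<rho>)"

definition characteristic_word :: "coding \<Rightarrow> real \<Rightarrow> nat \<Rightarrow> nat" where
  "characteristic_word c \<alpha> = sturmian_word c \<alpha> \<alpha>"

definition words :: "'a set \<Rightarrow> nat \<Rightarrow> 'a list set" where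
  "words A n = {w \<in> lists A. length w = n}"

definition block :: "(nat \<Rightarrow> 'a) \<Rightarrow> nat \<Rightarrow> nat \<Rightarrow> 'a list" where
  "block x i m = map x [i..<i + m]"

definition is_factor :: "'a list \<Rightarrow> (nat \<Rightarrow> 'a) \<Rightarrow> bool" where
  "is_factor w x \<longleftrightarrow> (\<exists>i. w = block x i (length w))"

text \<open>Meaningful only for \<open>n \<ge> l\<close>, because of the truncated subtraction \<open>n - l\<close>.\<close>

definition boundary :: "'a set \<Rightarrow> (nat \<Rightarrow> 'a) \<Rightarrow> nat \<Rightarrow> nat \<Rightarrow> ('a list \<times> 'a list) set" where
  "boundary A x l n =
     {(u, v) \<in> words A l \<times> words A l. \<exists>y \<in> words A (n - l). is_factor (u @ y @ v) x}"

end

theory Submission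
  imports Defs "HOL-Analysis.Kronecker_Approximation_Theorem"
begin

text \<open>
  For real \<open>x\<close> the letter coding \<open>frac x\<close> is the difference of the values of the floor function (or,
  in the other convention, the ceiling) at \<open>x + \<alpha>\<close> and \<open>x\<close>. Hence a block of length \<open>m\<close> starting at
  the point \<open>x\<close> is the same information as the integers \<open>\<lfloor>x + k\<alpha>\<rfloor> - \<lfloor>x\<rfloor>\<close> for \<open>k \<le> m\<close>. A pair in the
  boundary set at distance \<open>N > l\<close> comes from an orbit point \<open>x\<close> solving the inequalities
  \<open>m\<^sub>i \<le> x + a\<^sub>i \<le> m\<^sub>i + 1\<close>, where \<open>a\<^sub>i\<close> runs over \<open>k\<alpha>\<close> and \<open>(N + k)\<alpha>\<close>, \<open>k \<le> l\<close>. Solvability of such a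
  system only depends on the comparison of the differences \<open>a\<^sub>i - a\<^sub>j\<close> with integers, that is, on
  \<open>\<lfloor>(N + d)\<alpha>\<rfloor>\<close> for \<open>\<bar>d\<bar> \<le> l\<close>, and these integers are, up to a common summand, what a block of length
  \<open>2l\<close> of the characteristic word records. As \<open>\<alpha>\<close> is irrational and \<open>N > l\<close>, no difference with distinct
  indices is an integer, so the solution set contains an open interval, and the dense orbit of \<open>\<rho>\<close>
  meets it.
\<close>

section \<open>Letters as increments of an integer part\<close>

text \<open>Subtracting 1 from the ceiling makes both conventions agree off the integers and obey
  the same closed inequalities, so that \<open>c\<close> needs no case split once letters are
  coded.\<close>

definition coding_floor :: "coding \<Rightarrow> real \<Rightarrow> int" where
  "coding_floor c x = (case c of Left_closed \<Rightarrow> \<lfloor>x\<rfloor> | Right_closed \<Rightarrow> \<lceil>x\<rceil> - 1)"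

lemma coding_floor_le: "of_int (coding_floor c x) \<le> x"
  unfolding coding_floor_def by (cases c; simp; linarith)

lemma le_coding_floor_add_1: "x \<le> of_int (coding_floor c x) + 1"
  unfolding coding_floor_def by (cases c; simp; linarith)

lemma coding_floor_eq:
  assumes "of_int m < x" "x < of_int m + 1"
  shows "coding_floor c x = m"
  using assms unfolding coding_floor_def by (cases c; simp; linarith)

lemma coding_floor_add_of_int [simp]:
  "coding_floor c (x + of_int m) = coding_floor c x + m"
  by (cases c) (auto simp: coding_floor_def)

lemma coding_letter_frac:
  assumes "0 < \<alpha>" "\<alpha> < 1"
  shows "int (coding_letter c \<alpha> (frac x)) = coding_floor c (x + \<alpha>) - coding_floor c x"
proof -
  define y where "y = frac x"
  have y: "0 \<le> y" "y < 1"
    by (auto simp: y_def frac_lt_1)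
  have x: "x = y + of_int \<lfloor>x\<rfloor>"
    by (simp add: y_def frac_def)
  have "int (coding_letter c \<alpha> y) = coding_floor c (y + \<alpha>) - coding_floor c y"
  proof (cases c)
    case Left_closed
    have "\<lfloor>y + \<alpha>\<rfloor> = (if y < 1 - \<alpha> then 0 else 1)" "\<lfloor>y\<rfloor> = 0"
      using y assms by (auto simp: floor_eq_iff)
    then show ?thesis
      using y by (simp add: Left_closed coding_letter_def coding_floor_def)
  next
    case Right_closed
    \<comment> \<open>At \<open>y = 0\<close> the letter is 1, and the ceiling indeed steps from 0
      to 1.\<close>
    have "\<lceil>y + \<alpha>\<rceil> = (if y \<le> 1 - \<alpha> then 1 else 2)" "\<lceil>y\<rceil> = (if y = 0 then 0 else 1)"
      using y assms by (auto simp: ceiling_eq_iff)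
    then show ?thesis
      using y assms by (auto simp: Right_closed coding_letter_def coding_floor_def)
  qed
  also have "\<dots> = coding_floor c (y + \<alpha> + of_int \<lfloor>x\<rfloor>) - coding_floor c (y + of_int \<lfloor>x\<rfloor>)"
    by simp
  also have "y + \<alpha> + of_int \<lfloor>x\<rfloor> = x + \<alpha>"
    using x by linarith
  also have "y + of_int \<lfloor>x\<rfloor> = x"
    by (rule x[symmetric])
  finally show ?thesis
    by (simp only: y_def)
qed

lemma rotation_funpow:
  assumes "\<rho> \<in> unit_circle"
  shows "(rotation \<alpha> ^^ n) \<rho> = frac (\<rho> + real n * \<alpha>)"
proof (induction n)
  case 0
  show ?case
    using assms by (simp add: unit_circle_def frac_eq)
next
  case (Suc n)
  have "frac (frac (\<rho> + real n * \<alpha>) + \<alpha>) = frac (\<rho> + real n * \<alpha> + \<alpha>)"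
    by (simp add: frac_def algebra_simps)
  with Suc show ?case
    by (simp add: rotation_def algebra_simps)
qed

lemma sturmian_word_eq:
  assumes "0 < \<alpha>" "\<alpha> < 1" "\<rho> \<in> unit_circle"
  shows "int (sturmian_word c \<alpha> \<rho> n) =
    coding_floor c (\<rho> + real (Suc n) * \<alpha>) - coding_floor c (\<rho> + real n * \<alpha>)"
  using coding_letter_frac[OF assms(1,2), of c "\<rho> + real n * \<alpha>"] assms(3)
  by (simp add: sturmian_word_def rotation_funpow algebra_simps)

section \<open>Blocks and boundary sets\<close>

lemma length_block [simp]: "length (block x i m) = m"
  by (simp add: block_def)

lemma block_eq_iff: "block x i m = block y j m \<longleftrightarrow> (\<forall>k<m. x (i + k) = y (j + k))"
  by (auto simp: block_def list_eq_iff_nth_eq)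

lemma block_append: "block x i (m + n) = block x i m @ block x (i + m) n"
proof -
  have "[i..<i + (m + n)] = [i..<i + m] @ [i + m..<i + m + n]"
    using upt_add_eq_append[of i "i + m" n] by (simp add: add.assoc)
  then show ?thesis
    by (simp add: block_def)
qed

text \<open>Letters are increments, so this turns letterwise equality of blocks into equality of
  partial sums.\<close>

lemma telescope_eq_iff:
  fixes f g :: "nat \<Rightarrow> int"
  shows "(\<forall>k<m. f (Suc k) - f k = g (Suc k) - g k) \<longleftrightarrow> (\<forall>k\<le>m. f k - f 0 = g k - g 0)"
proof (induction m)
  case (Suc m)
  have "f (Suc m) - f m = g (Suc m) - g m \<longleftrightarrow> f (Suc m) - f 0 = g (Suc m) - g 0"
    if "f m - f 0 = g m - g 0"
    using that by linarith
  with Suc show ?case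
    by (auto simp: less_Suc_eq le_Suc_eq)
qed simp

lemma block_sturmian_eq_iff:
  assumes "0 < \<alpha>" "\<alpha> < 1" "\<rho> \<in> unit_circle" "\<sigma> \<in> unit_circle"
  shows "block (sturmian_word c \<alpha> \<rho>) i m = block (sturmian_word c \<alpha> \<sigma>) j m \<longleftrightarrow>
    (\<forall>k\<le>m. coding_floor c (\<rho> + real (i + k) * \<alpha>) - coding_floor c (\<rho> + real i * \<alpha>) =
           coding_floor c (\<sigma> + real (j + k) * \<alpha>) - coding_floor c (\<sigma> + real j * \<alpha>))"
proof -
  have "sturmian_word c \<alpha> \<rho> (i + k) = sturmian_word c \<alpha> \<sigma> (j + k) \<longleftrightarrow>
      coding_floor c (\<rho> + real (i + Suc k) * \<alpha>) - coding_floor c (\<rho> + real (i + k) * \<alpha>) =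
      coding_floor c (\<sigma> + real (j + Suc k) * \<alpha>) - coding_floor c (\<sigma> + real (j + k) * \<alpha>)" for k
    using sturmian_word_eq[OF assms(1-3), of c "i + k"]
      sturmian_word_eq[OF assms(1,2,4), of c "j + k"]
    by (metis add_Suc_right of_nat_eq_iff)
  then show ?thesis
    using telescope_eq_iff[of m "\<lambda>k. coding_floor c (\<rho> + real (i + k) * \<alpha>)"
        "\<lambda>k. coding_floor c (\<sigma> + real (j + k) * \<alpha>)"]
    by (simp add: block_eq_iff)
qed

lemma block_in_words:
  assumes "range x \<subseteq> A"
  shows "block x i m \<in> words A m"
  using assms by (auto simp: words_def block_def image_subset_iff)

text \<open>The middle word is whatever \<open>x\<close> has between the two blocks, so only the
  position \<open>i\<close> remains free; \<open>l \<le> N\<close> places \<open>v\<close> at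
  \<open>i + N\<close>.\<close>

lemma boundary_eq:
  assumes "range x \<subseteq> A" "l \<le> N"
  shows "boundary A x l N = range (\<lambda>i. (block x i l, block x (i + N) l))" (is "?L = ?R")
proof
  show "?L \<subseteq> ?R"
  proof
    fix p assume "p \<in> ?L"
    then obtain u v y i where p: "p = (u, v)" "length u = l" "length v = l" "length y = N - l"
      and "u @ y @ v = block x i (length (u @ y @ v))"
      by (auto simp: boundary_def words_def is_factor_def)
    then have "u @ y @ v = block x i (l + ((N - l) + l))"
      by simp
    then have "u = block x i l \<and> v = block x (i + N) l"
      using p assms(2) unfolding block_append by (simp add: add.assoc)
    with p show "p \<in> ?R"
      by auto
  qed
next
  show "?R \<subseteq> ?L"
  proof
    fix p assume "p \<in> ?R"
    then obtain i where p: "p = (block x i l, block x (i + N) l)"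
      by auto
    have "is_factor (block x i l @ block x (i + l) (N - l) @ block x (i + N) l) x"
      unfolding is_factor_def
      using block_append[of x i l "(N - l) + l"] block_append[of x "i + l" "N - l" l] assms(2)
      by (intro exI[of _ i]) (simp add: add.assoc)
    then show "p \<in> ?L"
      using assms(1) by (auto simp: boundary_def p intro!: block_in_words bexI)
  qed
qed

section \<open>Irrational orbits and systems of inequalities\<close>

lemma irrational_mult_int_neq:
  fixes \<alpha> :: real
  assumes "\<alpha> \<notin> \<rat>" "d \<noteq> 0"
  shows "of_int d * \<alpha> \<noteq> of_int M"
proof
  assume "of_int d * \<alpha> = of_int M"
  then have "\<alpha> = of_int M / of_int d"
    using assms(2) by (simp add: field_simps)
  then show False
    using assms(1) by simp
qed

text \<open>Kronecker's theorem gives density in the unit interval; the integer \<open>m\<close>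
  extends it to the line.\<close>

lemma orbit_meets_interval:
  fixes \<alpha> :: real
  assumes "\<alpha> \<notin> \<rat>" "L < U"
  obtains n :: nat and m :: int where "L < \<rho> + real n * \<alpha> + of_int m" "\<rho> + real n * \<alpha> + of_int m < U"
proof -
  define t where "t = (L + U) / 2 - \<rho>"
  obtain n :: nat where n: "\<bar>frac (real n * \<alpha>) - frac t\<bar> < (U - L) / 2"
    using Kronecker_approx_1_explicit[of \<alpha> "frac t" "(U - L) / 2"] assms
    by (auto simp: frac_lt_1 less_imp_le)
  define r where "r = \<rho> + real n * \<alpha> + of_int (\<lfloor>t\<rfloor> - \<lfloor>real n * \<alpha>\<rfloor>)"
  have "r - (L + U) / 2 = frac (real n * \<alpha>) - frac t"
    by (simp add: r_def t_def frac_def)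
  then have "\<bar>r - (L + U) / 2\<bar> < (U - L) / 2"
    using n by simp
  then have "L < r" "r < U"
    by (simp_all add: abs_less_iff field_simps)
  then show ?thesis
    using that unfolding r_def by blast
qed

text \<open>Finitely many open intervals on the line have a common open part once every lower
  endpoint lies below every upper one, a condition on pairs only. For \<open>i = j\<close> it holds
  because the intervals have length 1.\<close>

lemma transfer_unit_interval_system:
  fixes a b :: "'i \<Rightarrow> real" and m :: "'i \<Rightarrow> int"
  assumes "finite I" "I \<noteq> {}"
    and x: "\<And>i. i \<in> I \<Longrightarrow> of_int (m i) \<le> x + a i \<and> x + a i \<le> of_int (m i) + 1"
    and ab: "\<And>i j M. i \<in> I \<Longrightarrow> j \<in> I \<Longrightarrow> i \<noteq> j \<Longrightarrow> a i - a j \<le> of_int M \<Longrightarrow> b i - b j < of_int M"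
  obtains L U where "L < U"
    and "\<And>y i. L < y \<Longrightarrow> y < U \<Longrightarrow> i \<in> I \<Longrightarrow> of_int (m i) < y + b i \<and> y + b i < of_int (m i) + 1"
proof
  let ?L = "Max ((\<lambda>i. of_int (m i) - b i) ` I)" and ?U = "Min ((\<lambda>i. of_int (m i) + 1 - b i) ` I)"
  have "of_int (m i) - b i < of_int (m j) + 1 - b j" if "i \<in> I" "j \<in> I" for i j
  proof (cases "i = j")
    case False
    have "b j - b i < of_int (m j + 1 - m i)"
      using x[of i] x[of j] that False by (intro ab) (auto simp: algebra_simps)
    then show ?thesis
      by simp
  qed simp
  then show "?L < ?U"
    using assms(1,2) by (auto simp: Max_less_iff Min_gr_iff)
  show "of_int (m i) < y + b i \<and> y + b i < of_int (m i) + 1"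
    if y: "?L < y" "y < ?U" and i: "i \<in> I" for y i
  proof -
    have "of_int (m i) - b i < y" "y < of_int (m i) + 1 - b i"
      using y i assms(1,2) by auto
    then show ?thesis
      by linarith
  qed
qed

text \<open>This gives one inclusion between the boundary sets at \<open>l + 1 + n\<close> and
  \<open>l + 1 + n'\<close>; exchanging \<open>n\<close> and \<open>n'\<close> gives the
  other.\<close>

lemma boundary_determined:
  fixes \<alpha> \<rho> :: real
  assumes \<alpha>: "0 < \<alpha>" "\<alpha> < 1" "\<alpha> \<notin> \<rat>" and \<rho>: "\<rho> \<in> unit_circle"
    and blocks: "block (characteristic_word c \<alpha>) n (2 * l) = block (characteristic_word c \<alpha>) n' (2 * l)"
  shows "\<exists>i'. block (sturmian_word c \<alpha> \<rho>) i' l = block (sturmian_word c \<alpha> \<rho>) i l \<and>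
    block (sturmian_word c \<alpha> \<rho>) (i' + (l + 1 + n')) l = block (sturmian_word c \<alpha> \<rho>) (i + (l + 1 + n)) l"
proof -
  let ?cf = "coding_floor c"
  define N where "N = l + 1 + n"
  define N' where "N' = l + 1 + n'"
  \<comment> \<open>Equal blocks force the integer parts along the two runs to differ by this one
    constant.\<close>
  define q where "q = ?cf (\<alpha> + real n' * \<alpha>) - ?cf (\<alpha> + real n * \<alpha>)"
  have "\<alpha> \<in> unit_circle"
    using \<alpha> by (simp add: unit_circle_def)
  then have q: "?cf (\<alpha> + real (n' + k) * \<alpha>) = ?cf (\<alpha> + real (n + k) * \<alpha>) + q" if "k \<le> 2 * l" for k
    using blocks that \<alpha> by (force simp: characteristic_word_def block_sturmian_eq_iff q_def)
  \<comment> \<open>Here \<open>N + s - t = 1 + n + k\<close> with \<open>k = l + s - t\<close>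
    between 0 and \<open>2 * l\<close>; the 1 is the intercept \<alpha>.\<close>
  have shift: "?cf (of_int (int N' + int s - int t) * \<alpha>) = ?cf (of_int (int N + int s - int t) * \<alpha>) + q"
    if "s \<le> l" "t \<le> l" for s t
  proof -
    have "\<alpha> + real (n' + (l + s - t)) * \<alpha> = of_int (int N' + int s - int t) * \<alpha>"
      "\<alpha> + real (n + (l + s - t)) * \<alpha> = of_int (int N + int s - int t) * \<alpha>"
      using that by (auto simp: N_def N'_def of_nat_diff algebra_simps)
    then show ?thesis
      using q[of "l + s - t"] that by simp
  qed
  \<comment> \<open>Both distances exceed \<open>l\<close>, so the multiplier is positive. At
    distance \<open>l\<close> it would vanish for \<open>s = 0\<close>, \<open>t = l\<close>, hence
    the shift of the boundary sequence.\<close>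
  have neq: "of_int (int N' + int s - int t) * \<alpha> \<noteq> of_int M"
    "of_int (int N + int s - int t) * \<alpha> \<noteq> of_int M" if "t \<le> l" for s t M
    using that \<alpha> by (intro irrational_mult_int_neq; simp add: N_def N'_def)+
  define x where "x = \<rho> + real i * \<alpha>"
  define I where "I = (UNIV :: bool set) \<times> {..l}"
  define a where "a = (\<lambda>(e, k). (if e then real N * \<alpha> else 0) + real k * \<alpha>)"
  \<comment> \<open>Subtracting \<open>q\<close> lets the same integers \<open>m j\<close> serve as
    bounds for \<open>a\<close> and \<open>b\<close>.\<close>
  define b where "b = (\<lambda>(e, k). (if e then real N' * \<alpha> - of_int q else 0) + real k * \<alpha>)"
  define m where "m j = ?cf (x + a j)" for j
  obtain L U where "L < U" and LU: "\<And>y j. L < y \<Longrightarrow> y < U \<Longrightarrow> j \<in> I \<Longrightarrow>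
      of_int (m j) < y + b j \<and> y + b j < of_int (m j) + 1"
  proof (rule transfer_unit_interval_system)
    show "finite I" "I \<noteq> {}"
      by (auto simp: I_def)
    show "of_int (m j) \<le> x + a j \<and> x + a j \<le> of_int (m j) + 1" for j
      by (simp add: m_def coding_floor_le le_coding_floor_add_1)
    show "b j - b j' < of_int M"
      if j: "j \<in> I" "j' \<in> I" "j \<noteq> j'" and M: "a j - a j' \<le> of_int M" for j j' M
    proof -
      obtain e s e' t where jj: "j = (e, s)" "j' = (e', t)"
        by (cases j; cases j')
      have st: "s \<le> l" "t \<le> l"
        using j by (auto simp: I_def jj)
      consider "e = e'" | "e" "\<not> e'" | "\<not> e" "e'"
        by blast
      then show ?thesis
      proof cases
        case 1
        \<comment> \<open>Within one family the differences of \<open>a\<close> and \<open>b\<close>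
          coincide, and \<open>s \<noteq> t\<close>.\<close>
        then have "of_int (int s - int t) * \<alpha> \<noteq> of_int M"
          using \<alpha> j(3) by (intro irrational_mult_int_neq) (auto simp: jj)
        with 1 M show ?thesis
          by (auto simp: jj a_def b_def algebra_simps)
      next
        case 2
        \<comment> \<open>Irrationality makes the comparison with \<open>M\<close> strict; it then
          becomes one of integer parts, which \<open>shift\<close> carries to
          \<open>N'\<close>.\<close>
        let ?z = "of_int (int N + int s - int t) * \<alpha>" and ?z' = "of_int (int N' + int s - int t) * \<alpha>"
        have "?z < of_int M"
          using M 2 neq(2)[OF st(2), of s M] by (auto simp: jj a_def algebra_simps)
        then have "?cf ?z < M"
          using coding_floor_le[of c ?z] by linarith
        then have "?cf ?z' + 1 \<le> M + q"
          using shift[OF st] by linarith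
        then have "?z' \<le> of_int (M + q)"
          using le_coding_floor_add_1[of ?z' c] by linarith
        then have "?z' < of_int (M + q)"
          using neq(1)[OF st(2), of s "M + q"] by linarith
        with 2 show ?thesis
          by (simp add: jj b_def algebra_simps)
      next
        case 3
        let ?z = "of_int (int N + int t - int s) * \<alpha>" and ?z' = "of_int (int N' + int t - int s) * \<alpha>"
        have "of_int (- M) < ?z"
          using M 3 neq(2)[OF st(1), of t "- M"] by (auto simp: jj a_def algebra_simps)
        then have "- M \<le> ?cf ?z"
          using le_coding_floor_add_1[of ?z c] by linarith
        then have "- M + q \<le> ?cf ?z'"
          using shift[OF st(2,1)] by linarith
        then have "of_int (- M + q) \<le> ?z'"
          using coding_floor_le[of c ?z'] by linarith
        then have "of_int (- M + q) < ?z'"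
          using neq(1)[OF st(1), of t "- M + q"] by linarith
        with 3 show ?thesis
          by (simp add: jj b_def algebra_simps)
      qed
    qed
  qed blast
  obtain i' :: nat and h :: int where
    "L < \<rho> + real i' * \<alpha> + of_int h" "\<rho> + real i' * \<alpha> + of_int h < U"
    using orbit_meets_interval[OF \<alpha>(3) \<open>L < U\<close>] .
  then have m: "?cf (\<rho> + real i' * \<alpha> + of_int h + b j) = m j" if "j \<in> I" for j
    using LU that by (intro coding_floor_eq) auto
  \<comment> \<open>The offset \<open>h\<close> is independent of \<open>k\<close>, so it cancels
    when blocks are compared; likewise \<open>q - h\<close> below.\<close>
  have i'_eq: "?cf (\<rho> + real (i' + k) * \<alpha>) = ?cf (\<rho> + real (i + k) * \<alpha>) - h" if "k \<le> l" for k
  proof -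
    have "\<rho> + real i' * \<alpha> + of_int h + b (False, k) = \<rho> + real (i' + k) * \<alpha> + of_int h"
      "x + a (False, k) = \<rho> + real (i + k) * \<alpha>"
      by (simp_all add: a_def b_def x_def algebra_simps)
    moreover have "(False, k) \<in> I"
      using that by (simp add: I_def)
    ultimately have "?cf (\<rho> + real (i' + k) * \<alpha> + of_int h) = ?cf (\<rho> + real (i + k) * \<alpha>)"
      using m[of "(False, k)"] by (simp only: m_def)
    then show ?thesis
      unfolding coding_floor_add_of_int by linarith
  qed
  have i'N'_eq: "?cf (\<rho> + real (i' + N' + k) * \<alpha>) = ?cf (\<rho> + real (i + N + k) * \<alpha>) + q - h"
    if "k \<le> l" for k
  proof -
    have "\<rho> + real i' * \<alpha> + of_int h + b (True, k) = \<rho> + real (i' + N' + k) * \<alpha> + of_int (h - q)"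
      "x + a (True, k) = \<rho> + real (i + N + k) * \<alpha>"
      by (simp_all add: a_def b_def x_def algebra_simps)
    moreover have "(True, k) \<in> I"
      using that by (simp add: I_def)
    ultimately have "?cf (\<rho> + real (i' + N' + k) * \<alpha> + of_int (h - q)) = ?cf (\<rho> + real (i + N + k) * \<alpha>)"
      using m[of "(True, k)"] by (simp only: m_def)
    then show ?thesis
      unfolding coding_floor_add_of_int by linarith
  qed
  have "block (sturmian_word c \<alpha> \<rho>) i' l = block (sturmian_word c \<alpha> \<rho>) i l"
    unfolding block_sturmian_eq_iff[OF \<alpha>(1,2) \<rho> \<rho>]
    using i'_eq i'_eq[of 0] by (auto simp del: of_nat_add)
  moreover have "block (sturmian_word c \<alpha> \<rho>) (i' + N') l = block (sturmian_word c \<alpha> \<rho>) (i + N) l"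
    unfolding block_sturmian_eq_iff[OF \<alpha>(1,2) \<rho> \<rho>]
    using i'N'_eq i'N'_eq[of 0] by (auto simp del: of_nat_add)
  ultimately show ?thesis
    unfolding N_def N'_def by blast
qed

theorem theorem4p1:
  fixes \<alpha> \<rho> :: real and l :: nat and c :: coding
  assumes "\<alpha> \<in> unit_circle" and "\<alpha> \<notin> \<rat>" and "\<rho> \<in> unit_circle" and "l \<ge> 1"
  shows "\<exists>B \<in> words {0, 1} (2 * l) \<rightarrow> Pow (words {0, 1} l \<times> words {0, 1} l).
           \<forall>n. boundary {0, 1} (sturmian_word c \<alpha> \<rho>) l (l + 1 + n)
                 = B (block (characteristic_word c \<alpha>) n (2 * l))"
proof -
  let ?D = "\<lambda>n. boundary {0, 1} (sturmian_word c \<alpha> \<rho>) l (l + 1 + n)"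
  let ?w = "\<lambda>n. block (characteristic_word c \<alpha>) n (2 * l)"
  have \<alpha>: "0 < \<alpha>" "\<alpha> < 1"
    using assms(1,2) by (auto simp: unit_circle_def less_le)
  have "range (sturmian_word c \<alpha> \<rho>) \<subseteq> {0, 1}"
    by (auto simp: sturmian_word_def coding_letter_def)
  then have D: "?D n = range (\<lambda>i. (block (sturmian_word c \<alpha> \<rho>) i l,
      block (sturmian_word c \<alpha> \<rho>) (i + (l + 1 + n)) l))" for n
    by (rule boundary_eq) simp
  have "?D n \<subseteq> ?D n'" if w: "?w n = ?w n'" for n n'
  proof
    fix p assume "p \<in> ?D n"
    then obtain i where p: "p = (block (sturmian_word c \<alpha> \<rho>) i l,
        block (sturmian_word c \<alpha> \<rho>) (i + (l + 1 + n)) l)"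
      unfolding D by blast
    obtain i' where "block (sturmian_word c \<alpha> \<rho>) i' l = block (sturmian_word c \<alpha> \<rho>) i l"
      "block (sturmian_word c \<alpha> \<rho>) (i' + (l + 1 + n')) l = block (sturmian_word c \<alpha> \<rho>) (i + (l + 1 + n)) l"
      using boundary_determined[OF \<alpha> assms(2,3) w, of i] by blast
    then have "p = (block (sturmian_word c \<alpha> \<rho>) i' l, block (sturmian_word c \<alpha> \<rho>) (i' + (l + 1 + n')) l)"
      by (simp only: p)
    then show "p \<in> ?D n'"
      unfolding D by (rule range_eqI)
  qed
  then have D_eq: "?D n = ?D n'" if "?w n = ?w n'" for n n'
    using that by (intro equalityI) auto
  \<comment> \<open>By \<open>D_eq\<close> all sets in the union coincide; words that do not occur
    in the characteristic word get the empty set.\<close>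
  define B where "B w = (\<Union>n\<in>{n. ?w n = w}. ?D n)" for w
  have B: "?D n = B (?w n)" for n
  proof -
    have "(\<Union>n'\<in>{n'. ?w n' = ?w n}. ?D n') = (\<Union>n'\<in>{n'. ?w n' = ?w n}. ?D n)"
      by (rule SUP_cong[OF refl]) (rule D_eq, simp)
    then show ?thesis
      unfolding B_def by auto
  qed
  show ?thesis
  proof (intro bexI[of _ B] allI)
    show "?D n = B (?w n)" for n
      by (rule B)
    show "B \<in> words {0, 1} (2 * l) \<rightarrow> Pow (words {0, 1} l \<times> words {0, 1} l)"
      by (auto simp: B_def boundary_def)
  qed
qed

end
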